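(* For every integer $n\ge 1$, $$ \overline{SOME}(n)\equiv \begin{cases} 2 \pmod 4, & \text{if } n \text{ is an odd perfect square},\\ 0 \pmod 4, & \text{otherwise}. \end{cases} $$
   Context: An overpartition of a positive integer $n$ is a partition of $n$ in which the first occurrence of each part size may be overlined. $\overline{SOME}(n)$ is the sum of all odd parts minus the sum of all even parts, taken over all overpartitions of $n$ (parts counted with multiplicity, overlined or not). *)

theory Defs
  imports
    "HOL-Library.Multiset"
    "HOL-Number_Theory.Cong"
    "HOL-Computational_Algebra.Nth_Powers"
begin

text \<open>
  An overpartition is a pair \<open>(P, S)\<close>: the multiset \<open>P\<close> of (positive) parts, all occurrences
  counted, overlined or not, and the set \<open>S\<close> of those part sizes whose first occurrence is overlined.
\<close>

definition overpartitions :: "nat \<Rightarrow> (nat multiset \<times> nat set) set" where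
  "overpartitions n = {(P, S). 0 \<notin># P \<and> sum_mset P = n \<and> S \<subseteq> set_mset P}"

lemma finite_overpartitions: "finite (overpartitions n)"
proof -
  have "overpartitions n \<subseteq> (mset ` {xs. set xs \<subseteq> {..n} \<and> length xs \<le> n}) \<times> Pow {..n}"
  proof (clarsimp simp: overpartitions_def, intro conjI)
    fix P :: "nat multiset" and S
    assume P: "0 \<notin># P" and S: "S \<subseteq> set_mset P" and n: "n = sum_mset P"
    obtain xs where xs: "P = mset xs" by (metis ex_mset)
    have le: "x \<le> sum_mset P" if "x \<in># P" for x
      using that by (metis sum_mset.remove le_add1)
    have "length xs \<le> sum_list xs" if "0 \<notin> set xs" for xs :: "nat list"
      using that by (induction xs) auto
    then have "length xs \<le> sum_mset P"
      using P xs by (simp add: sum_mset_sum_list)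
    then show "P \<in> mset ` {xs. set xs \<subseteq> {..sum_mset P} \<and> length xs \<le> sum_mset P}"
      using xs le by auto
    show "S \<subseteq> {..sum_mset P}" using S le by auto
  qed
  then show ?thesis
    by (rule finite_subset) (simp add: finite_lists_length_le)
qed

definition SOME_bar :: "nat \<Rightarrow> int" where
  "SOME_bar n = (\<Sum>(P, S)\<in>overpartitions n.
     int (\<Sum>\<^sub># (filter_mset odd P)) - int (\<Sum>\<^sub># (filter_mset even P)))"

end

theory Submission
  imports Defs "HOL-Library.FuncSet"
begin

text \<open>
  A partition \<open>P\<close> with \<open>d\<close> distinct part sizes underlies \<open>2 ^ d\<close> overpartitions, and its signed sum
  has the parity of \<open>n\<close>. Modulo 4 only the partitions with a single part size survive; these
  correspond to the divisors of \<open>n\<close> and contribute \<open>2 * n\<close> each. The number of divisors of \<open>n\<close> is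
  odd exactly when \<open>n\<close> is a square.
\<close>

text \<open>The map \<open>d \<mapsto> n div d\<close> swaps the divisors below the square root of
  \<open>n\<close> (\<open>L\<close>) with those above it (\<open>G\<close>), so together they
  contribute an even number. The parity is decided by \<open>E\<close>, which holds the square root
  of \<open>n\<close> if there is one and is empty otherwise.\<close>

lemma odd_card_divisors_iff_is_square:
  fixes n :: nat
  assumes "n > 0"
  shows "odd (card {d. d dvd n}) \<longleftrightarrow> is_square n"
proof -
  define L E G where "L = {d. d dvd n \<and> d * d < n}" and "E = {d. d dvd n \<and> d * d = n}"
    and "G = {d. d dvd n \<and> d * d > n}"
  have fin: "finite L" "finite E" "finite G"
    using assms by (auto simp: L_def E_def G_def)
  have "bij_betw (\<lambda>d. n div d) L G"
  proof (rule bij_betwI[where g = "\<lambda>d. n div d"])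
    show "(\<lambda>d. n div d) \<in> L \<rightarrow> G"
    proof
      fix d assume "d \<in> L"
      \<comment> \<open>The cofactor \<open>e\<close> is \<open>n div d\<close>; cancelling
        \<open>d\<close> gives \<open>d < e\<close>, and multiplying by \<open>e\<close> gives
        \<open>n < e * e\<close>.\<close>
      then obtain e where e: "n = d * e" "d * d < d * e" by (auto simp: L_def elim!: dvdE)
      then have "d > 0" "d < e" by (auto intro: Nat.gr0I)
      then show "n div d \<in> G" using e by (auto simp: G_def)
    qed
    show "(\<lambda>d. n div d) \<in> G \<rightarrow> L"
    proof
      fix d assume "d \<in> G"
      then obtain e where e: "n = d * e" "d * d > d * e" by (auto simp: G_def elim!: dvdE)
      then have "d > 0" "e < d" "e > 0" using assms by (auto intro: Nat.gr0I)
      then show "n div d \<in> L" using e by (auto simp: L_def)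
    qed
  qed (use assms in \<open>auto simp: L_def G_def elim!: dvdE\<close>)
  then have "card L = card G" by (rule bij_betw_same_card)
  moreover have "{d. d dvd n} = (L \<union> G) \<union> E" by (auto simp: L_def E_def G_def)
  moreover have "card ((L \<union> G) \<union> E) = card L + card G + card E"
    using fin by (subst card_Un_disjoint, simp, simp, force simp: L_def E_def G_def)
      (subst card_Un_disjoint, auto simp: L_def G_def)
  ultimately have "odd (card {d. d dvd n}) \<longleftrightarrow> odd (card E)" by simp
  also have "\<dots> \<longleftrightarrow> is_square n"
  proof (cases "is_square n")
    case True
    then obtain m where m: "n = m ^ 2" by (auto elim: is_nth_powerE)
    then have "d = m" if "d * d = n" for d
      using that power2_eq_iff_nonneg[of d m] by (simp add: power2_eq_square)
    with m have "E = {m}" by (auto simp: E_def power2_eq_square)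
    with True show ?thesis by simp
  next
    case False
    then have "E = {}" by (auto simp: E_def is_nth_power_def power2_eq_square)
    with False show ?thesis by simp
  qed
  finally show ?thesis .
qed

definition partitions :: "nat \<Rightarrow> nat multiset set" where
  "partitions n = {P. 0 \<notin># P \<and> \<Sum>\<^sub># P = n}"

lemma overpartitions_eq_Sigma:
  "overpartitions n = Sigma (partitions n) (\<lambda>P. Pow (set_mset P))"
  by (auto simp: overpartitions_def partitions_def)

lemma finite_partitions: "finite (partitions n)"
proof -
  \<comment> \<open>Every partition is the first component of the overpartition with nothing
    overlined.\<close>
  have "partitions n \<subseteq> fst ` overpartitions n"
    by (force simp: overpartitions_eq_Sigma)
  then show ?thesis
    using finite_overpartitions finite_subset by blast
qed

definition signed_sum :: "nat multiset \<Rightarrow> int" where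
  "signed_sum P = int (\<Sum>\<^sub># (filter_mset odd P)) - int (\<Sum>\<^sub># (filter_mset even P))"

text \<open>The summand ignores the overlining, so each \<open>P\<close> is counted once for every
  subset of its part sizes.\<close>

lemma SOME_bar_eq_sum_partitions:
  "SOME_bar n = (\<Sum>P\<in>partitions n. 2 ^ card (set_mset P) * signed_sum P)"
proof -
  have "SOME_bar n = (\<Sum>P\<in>partitions n. \<Sum>S\<in>Pow (set_mset P). signed_sum P)"
    unfolding SOME_bar_def overpartitions_eq_Sigma signed_sum_def
    by (subst sum.Sigma) (auto simp: finite_partitions)
  then show ?thesis by (simp add: card_Pow)
qed

text \<open>Flipping the sign of a part does not change parity.\<close>

lemma even_signed_sum_iff: "even (signed_sum P) \<longleftrightarrow> even (\<Sum>\<^sub># P)"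
  by (induction P) (auto simp: signed_sum_def)

lemma bij_betw_divisors_partitions:
  assumes "n > 0"
  shows "bij_betw (\<lambda>d. replicate_mset (n div d) d) {d. d dvd n}
           {P \<in> partitions n. card (set_mset P) = 1}"
  unfolding bij_betw_def
proof
  have pos: "n div d > 0" if "d dvd n" for d
    using that assms by (auto elim!: dvdE)
  then have set: "set_mset (replicate_mset (n div d) d) = {d}" if "d dvd n" for d
    using that by simp
  show "inj_on (\<lambda>d. replicate_mset (n div d) d) {d. d dvd n}"
    \<comment> \<open>The divisor is recovered as the only element of the support, which is nonempty
      because \<open>n div d > 0\<close>.\<close>
    by (rule inj_onI) (metis set mem_Collect_eq singleton_inject)
  show "(\<lambda>d. replicate_mset (n div d) d) ` {d. d dvd n} =
          {P \<in> partitions n. card (set_mset P) = 1}"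
  proof (intro equalityI subsetI)
    fix P assume "P \<in> (\<lambda>d. replicate_mset (n div d) d) ` {d. d dvd n}"
    then show "P \<in> {P \<in> partitions n. card (set_mset P) = 1}"
      using assms set by (auto simp: partitions_def)
  next
    fix P assume P: "P \<in> {P \<in> partitions n. card (set_mset P) = 1}"
    then obtain d where "set_mset P = {d}" by (auto simp: card_1_singleton_iff)
    then have eq: "P = replicate_mset (count P d) d"
      by (intro multiset_eqI) (auto simp: count_eq_zero_iff)
    with P have "n = count P d * d"
      by (metis (mono_tags, lifting) mem_Collect_eq partitions_def sum_mset_replicate_mset of_nat_id)
    \<comment> \<open>Positivity of \<open>d\<close> makes \<open>n div d\<close> cancel to the
      multiplicity \<open>count P d\<close>.\<close>
    moreover have "d > 0" using P \<open>set_mset P = {d}\<close> by (auto simp: partitions_def intro: Nat.gr0I)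
    ultimately show "P \<in> (\<lambda>d. replicate_mset (n div d) d) ` {d. d dvd n}"
      using eq by (intro image_eqI[where x = d]) auto
  qed
qed

text \<open>For one part size the factor is 2, so \<open>signed_sum P\<close> matters only modulo 2,
  where it agrees with \<open>n\<close>. For two or more sizes the factor is divisible by 4.\<close>

lemma two_power_signed_sum_cong:
  assumes "P \<in> partitions n" "n > 0"
  shows "[2 ^ card (set_mset P) * signed_sum P =
          (if card (set_mset P) = 1 then 2 * int n else 0)] (mod 4)"
proof (cases "card (set_mset P) = 1")
  case True
  have "even (signed_sum P - int n)"
    using assms even_signed_sum_iff[of P] by (simp add: partitions_def)
  then obtain k where "signed_sum P = int n + 2 * k"
    by (metis dvdE diff_add_cancel add.commute)
  with True show ?thesis by (simp add: cong_iff_dvd_diff)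
next
  case False
  \<comment> \<open>This rules out zero part sizes, where the power of 2 would be 1.\<close>
  have "P \<noteq> {#}" using assms by (auto simp: partitions_def)
  with False have "2 \<le> card (set_mset P)"
    by (cases "card (set_mset P)") auto
  then have "(2::int) ^ 2 dvd 2 ^ card (set_mset P)" by (rule le_imp_power_dvd)
  with False show ?thesis by (simp add: cong_0_iff)
qed

theorem theorem3p2:
  fixes n :: nat
  assumes "n \<ge> 1"
  shows "[SOME_bar n = (if odd n \<and> is_square n then 2 else 0)] (mod 4)"
proof -
  from assms have n: "n > 0" by simp
  have "[SOME_bar n = (\<Sum>P\<in>partitions n. if card (set_mset P) = 1 then 2 * int n else 0)] (mod 4)"
    unfolding SOME_bar_eq_sum_partitions
    using n by (intro cong_sum two_power_signed_sum_cong)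
  also have "(\<Sum>P\<in>partitions n. if card (set_mset P) = 1 then 2 * int n else 0) =
      2 * int (n * card {P \<in> partitions n. card (set_mset P) = 1})"
    by (simp add: sum.If_cases finite_partitions Int_def)
  also have "card {P \<in> partitions n. card (set_mset P) = 1} = card {d. d dvd n}"
    using bij_betw_same_card[OF bij_betw_divisors_partitions[OF n]] by simp
  \<comment> \<open>Twice a number is 2 or 0 modulo 4 according to its parity, and the product is
    odd exactly when both \<open>n\<close> and its number of divisors are.\<close>
  also have "[2 * int (n * card {d. d dvd n}) = (if odd n \<and> is_square n then 2 else 0)] (mod 4)"
  proof (cases "odd n \<and> is_square n")
    case True
    then have "odd (n * card {d. d dvd n})"
      using odd_card_divisors_iff_is_square[OF n] by simp
    then obtain k where "n * card {d. d dvd n} = 2 * k + 1" by (elim oddE)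
    with True show ?thesis by (simp add: cong_iff_dvd_diff)
  next
    case False
    then have "even (n * card {d. d dvd n})"
      using odd_card_divisors_iff_is_square[OF n] by auto
    then obtain k where "n * card {d. d dvd n} = 2 * k" by (elim evenE)
    with False show ?thesis by (auto simp: cong_iff_dvd_diff)
  qed
  finally show ?thesis .
qed

end
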